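(* Let $X$ and $Y$ be two real random variables with finite means and distribution functions $F$ and $G$, respectively, and write $\overline F=1-F$, $\overline G=1-G$. (i) Let $p_0\in(0,1)$. If $X\leq_{p_0\text{-tvar}}Y$, then $\int_{x}^{+\infty}\overline F(t)\,dt\leq\int_{x}^{+\infty}\overline G(t)\,dt$ for all $x\geq F^{-1}(p_0)$. (ii) Let $x_0\in\mathbb R$. If $\int_{x}^{+\infty}\overline F(t)\,dt\leq\int_{x}^{+\infty}\overline G(t)\,dt$ for all $x\geq x_0$, then $X\leq_{G(x_0)\text{-tvar}}Y$.
   Context: For a random variable $X$ with distribution function $F$, the quantile function is $F^{-1}(p)=\inf\{x: F(x)\geq p\}$ for $p\in(0,1)$, and the tail value at risk is $\mathrm{TVaR}_p(X)=\frac{1}{1-p}\int_p^1 F^{-1}(u)\,du$ for $p\in[0,1)$. For $p_0\in[0,1)$, $X\leq_{p_0\text{-tvar}}Y$ means that $\mathrm{TVaR}_p(X)\leq\mathrm{TVaR}_p(Y)$ for all $p\in(p_0,1)$ (in the degenerate case where the index equals $1$ the condition is vacuous). $X$ and $Y$ need not have the same mean. *)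

theory Defs
  imports "HOL-Probability.Probability"
begin

definition dist_fun :: "'a measure \<Rightarrow> ('a \<Rightarrow> real) \<Rightarrow> real \<Rightarrow> real" where
  "dist_fun M X = cdf (distr M borel X)"

definition survival_fun :: "'a measure \<Rightarrow> ('a \<Rightarrow> real) \<Rightarrow> real \<Rightarrow> real" where
  "survival_fun M X t = 1 - dist_fun M X t"

(* Meaningful for 0 < p < 1 only, where the set is nonempty and bounded below
   when X is a real random variable. *)
definition quantile :: "'a measure \<Rightarrow> ('a \<Rightarrow> real) \<Rightarrow> real \<Rightarrow> real" where
  "quantile M X p = Inf {x. p \<le> dist_fun M X x}"

(* Meaningful for 0 \<le> p < 1. The open interval keeps the quantile function
   away from the endpoints 0 and 1, where it need not be a real number. *)
definition TVaR :: "'a measure \<Rightarrow> ('a \<Rightarrow> real) \<Rightarrow> real \<Rightarrow> real" where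
  "TVaR M X p = 1 / (1 - p) * (LBINT u:{p<..<1}. quantile M X u)"

(* X and Y may live on different probability spaces, since only their laws matter.
   For p0 = 1 the condition is vacuous. *)
definition tvar_le ::
  "real \<Rightarrow> 'a measure \<Rightarrow> ('a \<Rightarrow> real) \<Rightarrow> 'b measure \<Rightarrow> ('b \<Rightarrow> real) \<Rightarrow> bool" where
  "tvar_le p0 M X N Y \<longleftrightarrow> (\<forall>p\<in>{p0<..<1}. TVaR M X p \<le> TVaR N Y p)"

end

theory Submission
  imports Defs
begin

text \<open>
  Write \<open>\<pi>\<^sub>X x\<close> for the integral of the survival function of \<open>X\<close> over \<open>{x<..}\<close> (the stop-loss
  premium with retention \<open>x\<close>), \<open>Q\<^sub>X\<close> for the quantile function, and \<open>T\<^sub>X p\<close> for the integral of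
  \<open>Q\<^sub>X\<close> over \<open>(p, 1)\<close>, which is \<open>1 - p\<close> times the tail value at risk. Layer by layer,
  \<open>\<pi>\<^sub>X x\<close> is the expectation of \<open>max 0 (X - x)\<close> (\<open>stop_loss_eq_expectation\<close>). Since \<open>Q\<^sub>X\<close> has the
  law of \<open>X\<close> under the uniform distribution, it is also the integral of \<open>max 0 (Q\<^sub>X u - x)\<close> over
  \<open>(0, 1)\<close> (\<open>stop_loss_eq_quantile_integral\<close>). Discarding the part of this integral below \<open>p\<close>,
  and then the positive part, gives the inequality that carries everything,
  \<open>T\<^sub>X p - x * (1 - p) \<le> \<pi>\<^sub>X x\<close>,
  with equality as soon as \<open>Q\<^sub>X\<close> crosses the level \<open>x\<close> at \<open>p\<close>. (So \<open>\<pi>\<^sub>X\<close> and \<open>T\<^sub>X\<close> are conjugate to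
  each other.) Such a crossing happens at \<open>p = F x\<close>, for given \<open>x\<close>, and at \<open>x = Q\<^sub>X p\<close>, for given \<open>p\<close>.

  A comparison of one transform therefore gives a comparison of the other: choose the crossing point
  for the variable on the side where equality is needed, and use the plain inequality for the other
  variable. From tail values at risk to stop-loss premiums, equality is needed for \<open>X\<close>, so
  \<open>p = F x\<close>, and \<open>x \<ge> Q\<^sub>X p\<^sub>0\<close> says precisely that \<open>p \<ge> p\<^sub>0\<close>. The hypothesis covers only levels above
  \<open>p\<^sub>0\<close>, so \<open>p = p\<^sub>0\<close> is reached by right continuity of \<open>T\<^sub>X\<close>. In the other direction equality is
  needed for \<open>Y\<close>, so \<open>x = Q\<^sub>Y p\<close>, and \<open>p > G x\<^sub>0\<close> gives \<open>x \<ge> x\<^sub>0\<close>.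
\<close>

section \<open>The stop-loss transform as an expectation\<close>

lemma (in prob_space) borel_measurable_survival_fun:
  assumes [measurable]: "X \<in> borel_measurable M"
  shows "survival_fun M X \<in> borel_measurable borel"
proof -
  interpret D: real_distribution "distr M borel X" by (rule real_distribution_distr) simp
  have "dist_fun M X \<in> borel_measurable borel"
    unfolding dist_fun_def by (intro borel_measurable_mono monoI D.cdf_nondecreasing)
  then show ?thesis unfolding survival_fun_def by simp
qed

lemma (in prob_space) survival_fun_eq_prob:
  assumes [measurable]: "X \<in> borel_measurable M"
  shows "survival_fun M X t = prob {\<omega> \<in> space M. t < X \<omega>}"
proof -
  have "survival_fun M X t = 1 - prob {\<omega> \<in> space M. X \<omega> \<le> t}"
    by (simp add: survival_fun_def dist_fun_def cdf_def measure_distr vimage_def Int_def conj_commute)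
  also have "\<dots> = prob (space M - {\<omega> \<in> space M. X \<omega> \<le> t})"
    by (rule prob_compl[symmetric]) simp
  also have "space M - {\<omega> \<in> space M. X \<omega> \<le> t} = {\<omega> \<in> space M. t < X \<omega>}" by auto
  finally show ?thesis .
qed

text \<open>
  Both sides are the product measure of the region \<open>{(\<omega>, t). x < t \<and> t < X \<omega>}\<close>, sliced along \<open>t\<close>
  or along \<open>\<omega>\<close>. Everything is nonnegative, so Tonelli applies, and a possibly infinite value is
  turned into the real number 0 on both sides alike.
\<close>

lemma (in prob_space) stop_loss_eq_expectation:
  assumes [measurable]: "X \<in> borel_measurable M"
  shows "(LBINT t:{x<..}. survival_fun M X t) = expectation (\<lambda>\<omega>. max 0 (X \<omega> - x))"
proof -
  interpret pair_sigma_finite M lborel by standard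
  note borel_measurable_survival_fun[OF assms, measurable]
  have "(\<integral>\<^sup>+t. ennreal (indicator {x<..} t * survival_fun M X t) \<partial>lborel)
      = (\<integral>\<^sup>+t. (\<integral>\<^sup>+\<omega>. indicator {(\<omega>, t). x < t \<and> t < X \<omega>} (\<omega>, t) \<partial>M) \<partial>lborel)"
  proof (rule nn_integral_cong)
    fix t :: real
    have "(\<integral>\<^sup>+\<omega>. indicator {(\<omega>, t). x < t \<and> t < X \<omega>} (\<omega>, t) \<partial>M)
        = (\<integral>\<^sup>+\<omega>. indicator {x<..} t * indicator {\<omega> \<in> space M. t < X \<omega>} \<omega> \<partial>M)"
      by (intro nn_integral_cong) (auto split: split_indicator)
    also have "\<dots> = indicator {x<..} t * emeasure M {\<omega> \<in> space M. t < X \<omega>}"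
      by (simp add: nn_integral_cmult)
    also have "\<dots> = ennreal (indicator {x<..} t * survival_fun M X t)"
      by (simp add: survival_fun_eq_prob emeasure_eq_measure split: split_indicator)
    finally show "ennreal (indicator {x<..} t * survival_fun M X t)
        = (\<integral>\<^sup>+\<omega>. indicator {(\<omega>, t). x < t \<and> t < X \<omega>} (\<omega>, t) \<partial>M)" ..
  qed
  also have "\<dots> = (\<integral>\<^sup>+\<omega>. (\<integral>\<^sup>+t. indicator {(\<omega>, t). x < t \<and> t < X \<omega>} (\<omega>, t) \<partial>lborel) \<partial>M)"
    by (rule Fubini') measurable
  also have "\<dots> = (\<integral>\<^sup>+\<omega>. ennreal (max 0 (X \<omega> - x)) \<partial>M)"
  proof (rule nn_integral_cong)
    fix \<omega>
    have "(\<integral>\<^sup>+t. indicator {(\<omega>, t). x < t \<and> t < X \<omega>} (\<omega>, t) \<partial>lborel)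
        = (\<integral>\<^sup>+t. indicator {x<..<X \<omega>} t \<partial>lborel)"
      by (intro nn_integral_cong) (auto split: split_indicator)
    also have "\<dots> = ennreal (max 0 (X \<omega> - x))"
      by (cases "x \<le> X \<omega>") (auto simp: max_def)
    finally show "(\<integral>\<^sup>+t. indicator {(\<omega>, t). x < t \<and> t < X \<omega>} (\<omega>, t) \<partial>lborel)
        = ennreal (max 0 (X \<omega> - x))" .
  qed
  finally have "(\<integral>\<^sup>+t. ennreal (indicator {x<..} t * survival_fun M X t) \<partial>lborel)
      = (\<integral>\<^sup>+\<omega>. ennreal (max 0 (X \<omega> - x)) \<partial>M)" .
  moreover have "0 \<le> indicator {x<..} t * survival_fun M X t" for t
    by (simp add: survival_fun_eq_prob)
  ultimately show ?thesis
    unfolding set_lebesgue_integral_def by (simp add: integral_eq_nn_integral)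
qed

section \<open>The quantile transform\<close>

text \<open>
  The Galois connection between quantile and distribution function. It rests on the right continuity
  of the distribution function, which makes the infimum in the definition of the quantile a minimum.
\<close>

lemma (in prob_space) quantile_le_iff:
  assumes "X \<in> borel_measurable M" and "0 < p" and "p < 1"
  shows "quantile M X p \<le> x \<longleftrightarrow> p \<le> dist_fun M X x"
proof -
  interpret D: cdf_distribution "distr M borel X"
    unfolding cdf_distribution_def using assms(1) by (rule real_distribution_distr)
  show ?thesis
    unfolding quantile_def dist_fun_def by (rule D.pseudoinverse[OF assms(2,3), symmetric])
qed

lemma (in prob_space) quantile_mono:
  assumes "X \<in> borel_measurable M" and "0 < p" and "p \<le> q" and "q < 1"
  shows "quantile M X p \<le> quantile M X q"
proof -
  have "q \<le> dist_fun M X (quantile M X q)"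
    using quantile_le_iff[OF assms(1), of q "quantile M X q"] assms by simp
  then show ?thesis using quantile_le_iff[OF assms(1), of p] assms by simp
qed

text \<open>
  Inverse transform sampling. The uniform law lives on the open interval, because the quantile
  function has no meaning at 0 and 1.
\<close>

lemma (in prob_space) quantile_transform:
  assumes [measurable]: "X \<in> borel_measurable M"
  shows "quantile M X \<in> borel_measurable (restrict_space lborel {0<..<1})"
    and "distr (restrict_space lborel {0<..<1}) borel (quantile M X) = distr M borel X"
proof -
  interpret D: cdf_distribution "distr M borel X"
    unfolding cdf_distribution_def using assms(1) by (rule real_distribution_distr)
  have Q: "quantile M X = D.I" unfolding quantile_def dist_fun_def by auto
  have "sets (restrict_space lborel {0<..<1::real}) = sets (restrict_space borel {0<..<1})"
    by (rule sets_restrict_space_cong) simp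
  then show "quantile M X \<in> borel_measurable (restrict_space lborel {0<..<1})"
    unfolding Q using D.measurable_CI by (simp cong: measurable_cong_sets)
  show "distr (restrict_space lborel {0<..<1}) borel (quantile M X) = distr M borel X"
    unfolding Q by (rule D.distr_I_eq_M)
qed

text \<open>
  The change of variables that turns expectations of functions of \<open>X\<close> into integrals over
  quantile levels.
\<close>

lemma (in prob_space)
  fixes g :: "real \<Rightarrow> real"
  assumes [measurable]: "X \<in> borel_measurable M" "g \<in> borel_measurable borel"
  shows set_integrable_quantile_iff:
      "set_integrable lborel {0<..<1} (\<lambda>u. g (quantile M X u)) \<longleftrightarrow> integrable M (\<lambda>\<omega>. g (X \<omega>))"
    and set_integral_quantile:
      "(LBINT u:{0<..<1}. g (quantile M X u)) = expectation (\<lambda>\<omega>. g (X \<omega>))"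
proof -
  let ?U = "restrict_space lborel {0<..<1::real}"
  note Q[measurable] = quantile_transform(1)[OF assms(1)]
  have "integrable ?U (\<lambda>u. g (quantile M X u)) \<longleftrightarrow> integrable (distr ?U borel (quantile M X)) g"
    by (simp add: integrable_distr_eq)
  also have "\<dots> \<longleftrightarrow> integrable M (\<lambda>\<omega>. g (X \<omega>))"
    by (simp add: quantile_transform(2) integrable_distr_eq)
  finally show "set_integrable lborel {0<..<1} (\<lambda>u. g (quantile M X u)) \<longleftrightarrow> integrable M (\<lambda>\<omega>. g (X \<omega>))"
    by (simp add: integrable_restrict_space set_integrable_def)
  have "integral\<^sup>L ?U (\<lambda>u. g (quantile M X u)) = integral\<^sup>L (distr ?U borel (quantile M X)) g"
    by (simp add: integral_distr)
  also have "\<dots> = expectation (\<lambda>\<omega>. g (X \<omega>))"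
    by (simp add: quantile_transform(2) integral_distr)
  finally show "(LBINT u:{0<..<1}. g (quantile M X u)) = expectation (\<lambda>\<omega>. g (X \<omega>))"
    by (simp add: integral_restrict_space set_lebesgue_integral_def)
qed

lemma (in prob_space) set_integrable_quantile:
  assumes "integrable M X" and "0 \<le> p"
  shows "set_integrable lborel {p<..<1} (quantile M X)"
proof -
  have [measurable]: "X \<in> borel_measurable M" using assms(1) by simp
  have "set_integrable lborel {0<..<1} (quantile M X)"
    by (rule set_integrable_quantile_iff[THEN iffD2]) (use assms(1) in measurable)
  then show ?thesis by (rule set_integrable_subset) (use assms(2) in auto)
qed

lemma (in prob_space) stop_loss_eq_quantile_integral:
  assumes "X \<in> borel_measurable M"
  shows "(LBINT t:{x<..}. survival_fun M X t) = (LBINT u:{0<..<1}. max 0 (quantile M X u - x))"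
  unfolding stop_loss_eq_expectation[OF assms]
  by (rule set_integral_quantile[symmetric, OF assms]) measurable

section \<open>Upper quantile integrals against stop-loss premiums\<close>

lemma set_integral_diff_const_Ioo:
  fixes f :: "real \<Rightarrow> real"
  assumes "set_integrable lborel {p<..<q} f" and "p \<le> q"
  shows "set_integrable lborel {p<..<q} (\<lambda>u. f u - c)"
    and "(LBINT u:{p<..<q}. f u - c) = (LBINT u:{p<..<q}. f u) - c * (q - p)"
proof -
  have c: "set_integrable lborel {p<..<q} (\<lambda>_. c)"
    unfolding set_integrable_def using assms(2) by simp
  show "set_integrable lborel {p<..<q} (\<lambda>u. f u - c)"
    by (rule set_integral_diff(1)[OF assms(1) c])
  show "(LBINT u:{p<..<q}. f u - c) = (LBINT u:{p<..<q}. f u) - c * (q - p)"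
    using set_integral_diff(2)[OF assms(1) c] assms(2) by (simp add: set_integral_const)
qed

text \<open>
  On \<open>(p, 1)\<close> the integrand \<open>Q u - x\<close> is at most its positive part, and on \<open>(0, p]\<close> the positive part
  can only add to the right-hand side.
\<close>

lemma (in prob_space) quantile_integral_le_stop_loss:
  assumes X: "integrable M X" and p: "0 \<le> p" "p \<le> 1"
  shows "(LBINT u:{p<..<1}. quantile M X u) - x * (1 - p) \<le> (LBINT t:{x<..}. survival_fun M X t)"
proof -
  have [measurable]: "X \<in> borel_measurable M" using X by simp
  note Q = set_integrable_quantile[OF X p(1)]
  have I: "set_integrable lborel {0<..<1} (\<lambda>u. max 0 (quantile M X u - x))"
    using set_integrable_quantile_iff[of X "\<lambda>y. max 0 (y - x)"] X by simp
  have "(LBINT u:{p<..<1}. quantile M X u) - x * (1 - p) = (LBINT u:{p<..<1}. quantile M X u - x)"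
    using set_integral_diff_const_Ioo(2)[OF Q p(2)] by simp
  also have "\<dots> \<le> (LBINT u:{0<..<1}. max 0 (quantile M X u - x))"
    unfolding set_lebesgue_integral_def
    using set_integral_diff_const_Ioo(1)[OF Q p(2)] I p(1) unfolding set_integrable_def
    by (intro integral_mono) (auto split: split_indicator)
  finally show ?thesis by (simp add: stop_loss_eq_quantile_integral)
qed

text \<open>
  If the quantile function crosses the level \<open>x\<close> at \<open>p\<close>, both estimates in the preceding inequality
  are sharp: the positive part vanishes up to \<open>p\<close> and equals \<open>Q u - x\<close> beyond \<open>p\<close>.
\<close>

lemma (in prob_space) quantile_integral_eq_stop_loss:
  assumes X: "integrable M X" and p: "0 \<le> p" "p \<le> 1"
    and below: "\<And>u. 0 < u \<Longrightarrow> u < 1 \<Longrightarrow> u \<le> p \<Longrightarrow> quantile M X u \<le> x"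
    and above: "\<And>u. p < u \<Longrightarrow> u < 1 \<Longrightarrow> x \<le> quantile M X u"
  shows "(LBINT u:{p<..<1}. quantile M X u) - x * (1 - p) = (LBINT t:{x<..}. survival_fun M X t)"
proof -
  have [measurable]: "X \<in> borel_measurable M" using X by simp
  have "(LBINT u:{p<..<1}. quantile M X u) - x * (1 - p) = (LBINT u:{p<..<1}. quantile M X u - x)"
    using set_integral_diff_const_Ioo(2)[OF set_integrable_quantile[OF X p(1)] p(2)] by simp
  also have "\<dots> = (LBINT u:{0<..<1}. max 0 (quantile M X u - x))"
  proof -
    have "indicator {p<..<1} u * (quantile M X u - x)
        = indicator {0<..<1} u * max 0 (quantile M X u - x)" for u
      using below[of u] above[of u] p by (cases "u \<le> p") (auto simp: indicator_def)
    then show ?thesis by (simp add: set_lebesgue_integral_def)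
  qed
  finally show ?thesis by (simp add: stop_loss_eq_quantile_integral)
qed

text \<open>
  This is what extends a comparison of quantile integrals at all levels above \<open>p\<close> to the level \<open>p\<close>
  itself.
\<close>

lemma tendsto_set_integral_Ioo_at_right:
  fixes f :: "real \<Rightarrow> real"
  assumes "p < b" and "set_integrable lborel {p<..<b} f"
  shows "((\<lambda>q. LBINT u:{q<..<b}. f u) \<longlongrightarrow> (LBINT u:{p<..<b}. f u)) (at_right p)"
proof (rule tendsto_at_right_sequentially[OF assms(1)])
  fix S :: "nat \<Rightarrow> real"
  assume S: "\<And>n. p < S n" "\<And>n. S n < b" "decseq S" "S \<longlonglongrightarrow> p"
  have eq: "(\<Union>n. {S n<..<b}) = {p<..<b}"
  proof safe
    fix u n assume "u \<in> {S n<..<b}"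
    with S(1)[of n] show "u \<in> {p<..<b}" by auto
  next
    fix u assume "u \<in> {p<..<b}"
    with order_tendstoD(2)[OF S(4), of u] show "u \<in> (\<Union>n. {S n<..<b})"
      by (auto simp: eventually_sequentially)
  qed
  have "(\<lambda>n. LBINT u:{S n<..<b}. f u) \<longlonglongrightarrow> (LBINT u:(\<Union>n. {S n<..<b}). f u)"
  proof (rule set_integral_cont_up)
    show "incseq (\<lambda>n. {S n<..<b})"
      using decseqD[OF S(3)] by (fastforce simp: incseq_def)
    show "set_integrable lborel (\<Union>n. {S n<..<b}) f"
      unfolding eq by (rule assms(2))
  qed simp
  then show "(\<lambda>n. LBINT u:{S n<..<b}. f u) \<longlonglongrightarrow> (LBINT u:{p<..<b}. f u)"
    by (simp only: eq)
qed

section \<open>Comparison of tail values at risk and of stop-loss premiums\<close>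

lemma tvar_le_iff_quantile_integral_le:
  "tvar_le p0 M X N Y \<longleftrightarrow>
    (\<forall>p\<in>{p0<..<1}. (LBINT u:{p<..<1}. quantile M X u) \<le> (LBINT u:{p<..<1}. quantile N Y u))"
  unfolding tvar_le_def TVaR_def by (intro ball_cong refl mult_le_cancel_left_pos) simp

text \<open>
  The level \<open>p = F x\<close> makes the premium of \<open>X\<close> equal to \<open>T\<^sub>X p - x * (1 - p)\<close>. All levels \<open>q\<close> in
  \<open>(p, 1)\<close> lie above \<open>p0\<close>, and for them \<open>T\<^sub>X q - x * (1 - q) \<le> T\<^sub>Y q - x * (1 - q) \<le> \<pi>\<^sub>Y x\<close>. Letting
  \<open>q\<close> decrease to \<open>p\<close> treats \<open>p = p0\<close> and \<open>p > p0\<close> alike.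
\<close>

lemma stop_loss_le_if_tvar_le:
  fixes X :: "'a \<Rightarrow> real" and Y :: "'b \<Rightarrow> real"
  assumes "prob_space M" and "prob_space N" and X: "integrable M X" and Y: "integrable N Y"
    and p0: "0 < p0" "p0 < 1" and le: "tvar_le p0 M X N Y" and x: "quantile M X p0 \<le> x"
  shows "(LBINT t:{x<..}. survival_fun M X t) \<le> (LBINT t:{x<..}. survival_fun N Y t)"
proof -
  interpret M: prob_space M by fact
  interpret N: prob_space N by fact
  have mX: "X \<in> borel_measurable M" and mY: "Y \<in> borel_measurable N" using X Y by simp_all
  interpret D: real_distribution "distr M borel X" using mX by (rule M.real_distribution_distr)
  define p where "p = dist_fun M X x"
  have p: "p0 \<le> p" "p \<le> 1"
    using M.quantile_le_iff[OF mX p0] x D.cdf_bounded_prob[of x] by (auto simp: p_def dist_fun_def)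
  let ?TX = "\<lambda>q. LBINT u:{q<..<1}. quantile M X u"
  have "(LBINT t:{x<..}. survival_fun M X t) = ?TX p - x * (1 - p)"
  proof (rule M.quantile_integral_eq_stop_loss[OF X, symmetric])
    show "quantile M X u \<le> x" if "0 < u" "u < 1" "u \<le> p" for u
      using that M.quantile_le_iff[OF mX that(1,2)] by (simp add: p_def)
    show "x \<le> quantile M X u" if "p < u" "u < 1" for u
      using that p0 p M.quantile_le_iff[OF mX, of u x] by (simp add: p_def)
  qed (use p p0 in auto)
  also have "\<dots> \<le> (LBINT t:{x<..}. survival_fun N Y t)"
  proof (cases "p = 1")
    case True
    \<comment> \<open>There is no level above \<open>p\<close>, but \<open>X\<close> almost surely does not exceed \<open>x\<close>, so its premium is 0.\<close>
    then show ?thesis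
      using N.survival_fun_eq_prob[OF mY]
      by (auto simp: set_lebesgue_integral_def intro!: Bochner_Integration.integral_nonneg)
  next
    case False
    with p have "p < 1" by simp
    have "((\<lambda>q. ?TX q - x * (1 - q)) \<longlongrightarrow> ?TX p - x * (1 - p)) (at_right p)"
      using p p0 \<open>p < 1\<close>
      by (intro tendsto_intros tendsto_set_integral_Ioo_at_right M.set_integrable_quantile[OF X]) auto
    moreover have "\<forall>\<^sub>F q in at_right p. ?TX q - x * (1 - q) \<le> (LBINT t:{x<..}. survival_fun N Y t)"
      using eventually_at_right_less eventually_at_right_real[OF \<open>p < 1\<close>]
    proof eventually_elim
      case (elim q)
      then have "?TX q \<le> (LBINT u:{q<..<1}. quantile N Y u)"
        using le p unfolding tvar_le_iff_quantile_integral_le by auto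
      moreover have "(LBINT u:{q<..<1}. quantile N Y u) - x * (1 - q)
          \<le> (LBINT t:{x<..}. survival_fun N Y t)"
        using elim p p0 by (intro N.quantile_integral_le_stop_loss[OF Y]) auto
      ultimately show ?case by linarith
    qed
    ultimately show ?thesis by (rule tendsto_upperbound) simp
  qed
  finally show ?thesis .
qed

text \<open>
  The retention \<open>x = Q\<^sub>Y p\<close> makes the premium of \<open>Y\<close> equal to \<open>T\<^sub>Y p - x * (1 - p)\<close>, while the premium
  of \<open>X\<close> bounds \<open>T\<^sub>X p - x * (1 - p)\<close> from above.
\<close>

lemma tvar_le_if_stop_loss_le:
  fixes X :: "'a \<Rightarrow> real" and Y :: "'b \<Rightarrow> real"
  assumes "prob_space M" and "prob_space N" and X: "integrable M X" and Y: "integrable N Y"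
    and le: "\<And>x. x0 \<le> x \<Longrightarrow>
      (LBINT t:{x<..}. survival_fun M X t) \<le> (LBINT t:{x<..}. survival_fun N Y t)"
  shows "tvar_le (dist_fun N Y x0) M X N Y"
  unfolding tvar_le_iff_quantile_integral_le
proof
  interpret M: prob_space M by fact
  interpret N: prob_space N by fact
  have mY: "Y \<in> borel_measurable N" using Y by simp
  fix p assume p: "p \<in> {dist_fun N Y x0<..<1}"
  moreover have "0 \<le> dist_fun N Y x0" by (simp add: dist_fun_def cdf_def)
  ultimately have p01: "0 < p" "p < 1" by auto
  define x where "x = quantile N Y p"
  have "x0 \<le> x" using N.quantile_le_iff[OF mY p01, of x0] p by (simp add: x_def)
  have "(LBINT u:{p<..<1}. quantile M X u) - x * (1 - p) \<le> (LBINT t:{x<..}. survival_fun M X t)"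
    using p01 by (intro M.quantile_integral_le_stop_loss[OF X]) auto
  also have "\<dots> \<le> (LBINT t:{x<..}. survival_fun N Y t)" by (rule le) fact
  also have "\<dots> = (LBINT u:{p<..<1}. quantile N Y u) - x * (1 - p)"
    using p01 unfolding x_def
    by (intro N.quantile_integral_eq_stop_loss[OF Y, symmetric] N.quantile_mono[OF mY]) auto
  finally show "(LBINT u:{p<..<1}. quantile M X u) \<le> (LBINT u:{p<..<1}. quantile N Y u)" by simp
qed

theorem proposition2p7:
  fixes M :: "'a measure" and N :: "'b measure"
    and X :: "'a \<Rightarrow> real" and Y :: "'b \<Rightarrow> real"
  assumes "prob_space M" and "prob_space N"
    and "integrable M X" and "integrable N Y"
  shows "(\<forall>p0\<in>{0<..<1}. tvar_le p0 M X N Y \<longrightarrow>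
            (\<forall>x\<ge>quantile M X p0.
               (LBINT t:{x<..}. survival_fun M X t) \<le> (LBINT t:{x<..}. survival_fun N Y t))) \<and>
         (\<forall>x0. (\<forall>x\<ge>x0.
               (LBINT t:{x<..}. survival_fun M X t) \<le> (LBINT t:{x<..}. survival_fun N Y t)) \<longrightarrow>
            tvar_le (dist_fun N Y x0) M X N Y)"
proof (intro conjI ballI allI impI)
  fix p0 x
  assume "p0 \<in> {0<..<1}" and "tvar_le p0 M X N Y" and "quantile M X p0 \<le> x"
  then show "(LBINT t:{x<..}. survival_fun M X t) \<le> (LBINT t:{x<..}. survival_fun N Y t)"
    by (intro stop_loss_le_if_tvar_le[OF assms, of p0]) simp_all
next
  fix x0
  assume le: "\<forall>x\<ge>x0.
    (LBINT t:{x<..}. survival_fun M X t) \<le> (LBINT t:{x<..}. survival_fun N Y t)"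
  show "tvar_le (dist_fun N Y x0) M X N Y"
    by (rule tvar_le_if_stop_loss_le[OF assms]) (rule le[rule_format])
qed

end
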